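(* The class of $\omega$-regular languages is a strict subclass of the class of $\omega$-languages recognized by deterministic limit Parikh automata: every $\omega$-regular language is recognized by a deterministic limit Parikh automaton, and there is an $\omega$-language recognized by a deterministic limit Parikh automaton that is not $\omega$-regular.
   Context: An $\omega$-language $L\subseteq\Sigma^\omega$ is $\omega$-regular if it is recognized by some (non-deterministic) Büchi automaton. $\mathbb{N}=\{0,1,2,\dots\}$ and $\mathbb{N}_\infty=\mathbb{N}\cup\{\infty\}$, with $z+\infty=\infty+z=\infty+\infty=\infty$ for $z\in\mathbb{N}$, $z\cdot\infty=\infty\cdot z=\infty$ for $z\ge 1$, and $0\cdot\infty=\infty\cdot 0=0$; operations on vectors are component-wise. A linear set over $\mathbb{N}_\infty^d$ is a set $C(\mathbf{b},P)=\{\mathbf{b}+\mathbf{p}_1z_1+\dots+\mathbf{p}_\ell z_\ell \mid z_1,\dots,z_\ell\in\mathbb{N}\}$ with $\mathbf{b}\in\mathbb{N}_\infty^d$ and $P=\{\mathbf{p}_1,\dots,\mathbf{p}_\ell\}\subseteq\mathbb{N}_\infty^d$ finite ($\ell\ge 0$); a semi-linear set is a finite union of linear sets. A limit Parikh automaton (limit PA) of dimension $d\ge 1$ is a tuple $\mathcal{A}=(Q,\Sigma,q_0,\Delta,F,C)$ with a finite state set $Q$, a finite non-empty alphabet $\Sigma$, an initial state $q_0\in Q$, a finite set of labeled transitions $\Delta\subseteq Q\times\Sigma\times\mathbb{N}^d\times Q$, a set of accepting states $F\subseteq Q$, and a semi-linear set $C\subseteq\mathbb{N}_\infty^d$. It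 is deterministic if for every $(p,a)\in Q\times\Sigma$ there is exactly one transition $(p,a,\mathbf{v},q)\in\Delta$. A run on $\alpha=\alpha_1\alpha_2\dots\in\Sigma^\omega$ is an infinite sequence $r=r_1r_2\dots$ with $r_i=(p_{i-1},\alpha_i,\mathbf{v}_i,p_i)\in\Delta$ and $p_0=q_0$. It is accepting if $p_i\in F$ for infinitely many $i\ge 1$ and $\rho(r)\in C$, where the $j$th component of $\rho(r)\in\mathbb{N}_\infty^d$ is $\infty$ if infinitely many $\mathbf{v}_i$ have a non-zero $j$th component, and otherwise is the (finite) sum of the $j$th components of all $\mathbf{v}_i$. The recognized $\omega$-language is the set of all $\alpha\in\Sigma^\omega$ on which there is an accepting run. *)

theory Defs
  imports "HOL-Library.Omega_Words_Fun" "HOL-Library.Extended_Nat"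
begin

section \<open>Semi-linear sets\<close>

text \<open>
  Vectors of dimension \<open>d\<close> are lists of length \<open>d\<close>, since \<open>d\<close> is a component of each automaton.
  The arithmetic of \<^typ>\<open>enat\<close> obeys \<open>0 * \<infinity> = \<infinity> * 0 = 0\<close>.
\<close>

definition linear_set :: "nat \<Rightarrow> enat list \<Rightarrow> enat list set \<Rightarrow> enat list set" where
  "linear_set d b P =
     {map (\<lambda>j. b ! j + (\<Sum>p\<in>P. p ! j * enat (z p))) [0..<d] | z :: enat list \<Rightarrow> nat. True}"

definition is_linear :: "nat \<Rightarrow> enat list set \<Rightarrow> bool" where
  "is_linear d S \<longleftrightarrow>
     (\<exists>b P. length b = d \<and> finite P \<and> (\<forall>p\<in>P. length p = d) \<and> S = linear_set d b P)"

definition is_semilinear :: "nat \<Rightarrow> enat list set \<Rightarrow> bool" where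
  "is_semilinear d C \<longleftrightarrow> (\<exists>\<S>. finite \<S> \<and> (\<forall>S\<in>\<S>. is_linear d S) \<and> C = \<Union>\<S>)"


section \<open>Buechi automata\<close>

record ('q, 'a, 't) automaton =
  states :: "'q set"
  alphabet :: "'a set"
  initial :: 'q
  transitions :: "'t set"
  accepting :: "'q set"

type_synonym ('q, 'a) buchi = "('q, 'a, 'q \<times> 'a \<times> 'q) automaton"

definition wf_base :: "('q, 'a, 't, 'z) automaton_scheme \<Rightarrow> bool" where
  "wf_base A \<longleftrightarrow> finite (states A) \<and> finite (alphabet A) \<and> alphabet A \<noteq> {} \<and>
     initial A \<in> states A \<and> accepting A \<subseteq> states A \<and> finite (transitions A)"

definition wf_buchi :: "('q, 'a) buchi \<Rightarrow> bool" where
  "wf_buchi A \<longleftrightarrow> wf_base A \<and> transitions A \<subseteq> states A \<times> alphabet A \<times> states A"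

definition buchi_run :: "('q, 'a) buchi \<Rightarrow> 'a word \<Rightarrow> 'q word \<Rightarrow> bool" where
  "buchi_run A \<alpha> p \<longleftrightarrow> p 0 = initial A \<and> (\<forall>i. (p i, \<alpha> i, p (Suc i)) \<in> transitions A)"

definition buchi_language :: "('q, 'a) buchi \<Rightarrow> 'a word set" where
  "buchi_language A = {\<alpha>. range \<alpha> \<subseteq> alphabet A \<and>
     (\<exists>p. buchi_run A \<alpha> p \<and> (\<exists>\<^sub>\<infinity>i. p i \<in> accepting A))}"

text \<open>
  State sets are finite, so it is no restriction to let states be natural numbers; see
  \<open>omega_regularI\<close> and \<open>det_limit_PA_recognizableI\<close> below.
\<close>

definition omega_regular :: "'a set \<Rightarrow> 'a word set \<Rightarrow> bool" where
  "omega_regular \<Sigma> L \<longleftrightarrow>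
     (\<exists>A :: (nat, 'a) buchi. wf_buchi A \<and> alphabet A = \<Sigma> \<and> buchi_language A = L)"


section \<open>Limit Parikh automata\<close>

record ('q, 'a) limit_PA = "('q, 'a, 'q \<times> 'a \<times> nat list \<times> 'q) automaton" +
  pa_dim :: nat
  pa_set :: "enat list set"

definition wf_limit_PA :: "('q, 'a) limit_PA \<Rightarrow> bool" where
  "wf_limit_PA A \<longleftrightarrow> wf_base A \<and> 1 \<le> pa_dim A \<and>
     transitions A \<subseteq> states A \<times> alphabet A \<times> {v. length v = pa_dim A} \<times> states A \<and>
     is_semilinear (pa_dim A) (pa_set A)"

definition deterministic :: "('q, 'a) limit_PA \<Rightarrow> bool" where
  "deterministic A \<longleftrightarrow>
     (\<forall>p\<in>states A. \<forall>a\<in>alphabet A. \<exists>!vq. (p, a, vq) \<in> transitions A)"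

text \<open>
  A run is given by its states \<open>p 0, p 1, \<dots>\<close> and its vectors, where \<open>v i\<close> labels the transition
  from \<open>p i\<close> to \<open>p (Suc i)\<close>.
\<close>

definition limit_PA_run ::
    "('q, 'a) limit_PA \<Rightarrow> 'a word \<Rightarrow> 'q word \<Rightarrow> nat list word \<Rightarrow> bool" where
  "limit_PA_run A \<alpha> p v \<longleftrightarrow>
     p 0 = initial A \<and> (\<forall>i. (p i, \<alpha> i, v i, p (Suc i)) \<in> transitions A)"

definition extended_parikh_image :: "nat \<Rightarrow> nat list word \<Rightarrow> enat list" where
  "extended_parikh_image d v =
     map (\<lambda>j. if \<exists>\<^sub>\<infinity>i. v i ! j \<noteq> 0 then \<infinity> else enat (\<Sum>i | v i ! j \<noteq> 0. v i ! j)) [0..<d]"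

definition limit_PA_language :: "('q, 'a) limit_PA \<Rightarrow> 'a word set" where
  "limit_PA_language A = {\<alpha>. range \<alpha> \<subseteq> alphabet A \<and>
     (\<exists>p v. limit_PA_run A \<alpha> p v \<and> (\<exists>\<^sub>\<infinity>i. p i \<in> accepting A) \<and>
        extended_parikh_image (pa_dim A) v \<in> pa_set A)}"

definition det_limit_PA_recognizable :: "'a set \<Rightarrow> 'a word set \<Rightarrow> bool" where
  "det_limit_PA_recognizable \<Sigma> L \<longleftrightarrow>
     (\<exists>A :: (nat, 'a) limit_PA. wf_limit_PA A \<and> deterministic A \<and> alphabet A = \<Sigma> \<and>
        limit_PA_language A = L)"


section \<open>Independence of the type of states\<close>

lemma omega_regularI:
  fixes A :: "('q, 'a) buchi"
  assumes wf: "wf_buchi A"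
  shows "omega_regular (alphabet A) (buchi_language A)"
proof -
  have "finite (states A)" using wf by (simp add: wf_buchi_def wf_base_def)
  then obtain f :: "'q \<Rightarrow> nat" where f: "inj_on f (states A)"
    by (meson finite_imp_inj_to_nat_seg)
  let ?m = "\<lambda>(p, a, q). (f p, a, f q)"
  define B :: "(nat, 'a) buchi" where
    "B = \<lparr>states = f ` states A, alphabet = alphabet A, initial = f (initial A),
      transitions = ?m ` transitions A, accepting = f ` accepting A\<rparr>"
  have tr: "transitions A \<subseteq> states A \<times> alphabet A \<times> states A"
    and acc: "accepting A \<subseteq> states A" and ini: "initial A \<in> states A"
    using wf by (auto simp: wf_buchi_def wf_base_def)
  have wfB: "wf_buchi B"
    using wf unfolding wf_buchi_def wf_base_def B_def by fastforce
  have "\<alpha> \<in> buchi_language B" if "\<alpha> \<in> buchi_language A" for \<alpha>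
  proof -
    from that obtain p where p: "range \<alpha> \<subseteq> alphabet A" "buchi_run A \<alpha> p"
      "\<exists>\<^sub>\<infinity>i. p i \<in> accepting A" by (auto simp: buchi_language_def)
    have "buchi_run B \<alpha> (f \<circ> p)"
      using p(2) by (force simp: buchi_run_def B_def)
    moreover have "\<exists>\<^sub>\<infinity>i. (f \<circ> p) i \<in> accepting B"
      using p(3) by (rule INFM_mono) (auto simp: B_def)
    ultimately show ?thesis using p(1) by (auto simp: buchi_language_def B_def)
  qed
  moreover have "\<alpha> \<in> buchi_language A" if "\<alpha> \<in> buchi_language B" for \<alpha>
  proof -
    from that obtain p where p: "range \<alpha> \<subseteq> alphabet A" "buchi_run B \<alpha> p"
      "\<exists>\<^sub>\<infinity>i. p i \<in> accepting B" by (auto simp: buchi_language_def B_def)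
    let ?g = "inv_into (states A) f"
    have "(?g (p i), \<alpha> i, ?g (p (Suc i))) \<in> transitions A" for i
    proof -
      have "(p i, \<alpha> i, p (Suc i)) \<in> transitions B" using p(2) by (simp add: buchi_run_def)
      then obtain x y where "(x, \<alpha> i, y) \<in> transitions A" "p i = f x" "p (Suc i) = f y"
        by (auto simp: B_def)
      then show ?thesis using tr f by (auto simp: inv_into_f_f)
    qed
    moreover have "?g (p 0) = initial A"
      using p(2) ini f by (simp add: buchi_run_def B_def)
    moreover have "\<exists>\<^sub>\<infinity>i. ?g (p i) \<in> accepting A"
      using p(3) by (rule INFM_mono) (use acc f in \<open>auto simp: B_def\<close>)
    ultimately show ?thesis
      using p(1) unfolding buchi_language_def buchi_run_def
      by (intro CollectI conjI exI[of _ "\<lambda>i. ?g (p i)"]) auto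
  qed
  ultimately have "buchi_language B = buchi_language A" by blast
  moreover have "alphabet B = alphabet A" by (simp add: B_def)
  ultimately show ?thesis using wfB unfolding omega_regular_def by blast
qed

lemma det_limit_PA_recognizableI:
  fixes A :: "('q, 'a) limit_PA"
  assumes wf: "wf_limit_PA A" and det: "deterministic A"
  shows "det_limit_PA_recognizable (alphabet A) (limit_PA_language A)"
proof -
  have "finite (states A)" using wf by (simp add: wf_limit_PA_def wf_base_def)
  then obtain f :: "'q \<Rightarrow> nat" where f: "inj_on f (states A)"
    by (meson finite_imp_inj_to_nat_seg)
  let ?m = "\<lambda>(p, a, v, q). (f p, a, v, f q)"
  define B :: "(nat, 'a) limit_PA" where
    "B = \<lparr>states = f ` states A, alphabet = alphabet A, initial = f (initial A),
      transitions = ?m ` transitions A, accepting = f ` accepting A,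
      pa_dim = pa_dim A, pa_set = pa_set A\<rparr>"
  have tr: "transitions A \<subseteq> states A \<times> alphabet A \<times> {v. length v = pa_dim A} \<times> states A"
    and acc: "accepting A \<subseteq> states A" and ini: "initial A \<in> states A"
    using wf by (auto simp: wf_limit_PA_def wf_base_def)
  have wfB: "wf_limit_PA B"
    using wf unfolding wf_limit_PA_def wf_base_def B_def by fastforce
  have detB: "deterministic B"
    unfolding deterministic_def
  proof (intro ballI)
    fix p a assume "p \<in> states B" "a \<in> alphabet B"
    then obtain x where x: "x \<in> states A" "p = f x" "a \<in> alphabet A" by (auto simp: B_def)
    then obtain v q where vq: "(x, a, v, q) \<in> transitions A"
      and uniq: "\<And>w. (x, a, w) \<in> transitions A \<Longrightarrow> w = (v, q)"
      using det unfolding deterministic_def by (metis surj_pair)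
    show "\<exists>!vq. (p, a, vq) \<in> transitions B"
    proof (rule ex1I[of _ "(v, f q)"])
      show "(p, a, v, f q) \<in> transitions B" using vq x by (force simp: B_def)
    next
      fix w assume "(p, a, w) \<in> transitions B"
      then obtain y u q' where y: "(y, a, u, q') \<in> transitions A" "p = f y" "w = (u, f q')"
        by (auto simp: B_def)
      have "y = x" using y x tr f by (auto dest: inj_onD)
      then show "w = (v, f q)" using uniq y by auto
    qed
  qed
  have "\<alpha> \<in> limit_PA_language B" if "\<alpha> \<in> limit_PA_language A" for \<alpha>
  proof -
    from that obtain p v where p: "range \<alpha> \<subseteq> alphabet A" "limit_PA_run A \<alpha> p v"
      "\<exists>\<^sub>\<infinity>i. p i \<in> accepting A" "extended_parikh_image (pa_dim A) v \<in> pa_set A"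
      by (auto simp: limit_PA_language_def)
    have "limit_PA_run B \<alpha> (f \<circ> p) v"
      using p(2) by (force simp: limit_PA_run_def B_def)
    moreover have "\<exists>\<^sub>\<infinity>i. (f \<circ> p) i \<in> accepting B"
      using p(3) by (rule INFM_mono) (auto simp: B_def)
    ultimately have "\<exists>p v. limit_PA_run B \<alpha> p v \<and> (\<exists>\<^sub>\<infinity>i. p i \<in> accepting B) \<and>
        extended_parikh_image (pa_dim B) v \<in> pa_set B"
      using p(4) by (intro exI[of _ "f \<circ> p"] exI[of _ v]) (simp add: B_def)
    then show ?thesis using p(1) by (simp add: limit_PA_language_def B_def)
  qed
  moreover have "\<alpha> \<in> limit_PA_language A" if "\<alpha> \<in> limit_PA_language B" for \<alpha>
  proof -
    from that obtain p v where p: "range \<alpha> \<subseteq> alphabet A" "limit_PA_run B \<alpha> p v"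
      "\<exists>\<^sub>\<infinity>i. p i \<in> accepting B" "extended_parikh_image (pa_dim A) v \<in> pa_set A"
      by (auto simp: limit_PA_language_def B_def)
    let ?g = "inv_into (states A) f"
    have "(?g (p i), \<alpha> i, v i, ?g (p (Suc i))) \<in> transitions A" for i
    proof -
      have "(p i, \<alpha> i, v i, p (Suc i)) \<in> transitions B"
        using p(2) by (simp add: limit_PA_run_def)
      then obtain x y where "(x, \<alpha> i, v i, y) \<in> transitions A" "p i = f x" "p (Suc i) = f y"
        by (auto simp: B_def)
      then show ?thesis using tr f by (auto simp: inv_into_f_f)
    qed
    moreover have "?g (p 0) = initial A"
      using p(2) ini f by (simp add: limit_PA_run_def B_def)
    moreover have "\<exists>\<^sub>\<infinity>i. ?g (p i) \<in> accepting A"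
      using p(3) by (rule INFM_mono) (use acc f in \<open>auto simp: B_def\<close>)
    ultimately show ?thesis
      using p(1,4) unfolding limit_PA_language_def limit_PA_run_def
      by (intro CollectI conjI exI[of _ "\<lambda>i. ?g (p i)"] exI[of _ v]) auto
  qed
  ultimately have "limit_PA_language B = limit_PA_language A" by blast
  moreover have "alphabet B = alphabet A" by (simp add: B_def)
  ultimately show ?thesis
    using wfB detB unfolding det_limit_PA_recognizable_def by blast
qed

end

theory Submission
  imports Defs
begin

text \<open>
  Limit acceptance can express every Muller condition: give each transition its own counter and
  ask which counters are infinite. So for the inclusion a Buechi automaton has to be turned into
  a deterministic Muller automaton.

  The profile of a finite word is the set of all \<open>(p, q, b)\<close> such that the word leads from \<open>p\<close> to
  \<open>q\<close>, with \<open>b\<close> telling whether an accepting state is passed. Call positions \<open>k\<close> and \<open>l\<close>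
  of \<open>\<alpha>\<close> equivalent if \<open>\<alpha>[k..n)\<close> and \<open>\<alpha>[l..n)\<close> have the same profile for some (hence every later)
  \<open>n\<close>. There are finitely many classes because there are finitely many profiles. The deterministic
  automaton stores after \<open>n\<close> letters the distinct profiles of all \<open>\<alpha>[k..n)\<close>, ordered by the oldest
  position they stand for. The entry of the oldest member \<open>k\<^sub>0\<close> of an infinite class
  eventually has a fixed rank, counted from the old end, and from then on absorbs younger
  entries infinitely often; conversely, an entry which eventually keeps its rank and absorbs
  infinitely often belongs to an infinite class. Let \<open>x\<close> and \<open>e\<close> be the profiles of \<open>\<alpha>[0..n)\<close>
  and \<open>\<alpha>[k\<^sub>0..n)\<close> for infinitely many \<open>n\<close>. Then \<open>\<alpha>\<close> factorises into words with profiles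
  \<open>x, z\<^sub>0, z\<^sub>1, \<dots>\<close> where \<open>e z\<^sub>j = e\<close> and \<open>z\<^sub>j e = z\<^sub>j\<close>, so \<open>\<alpha>\<close> is accepted as soon as a word with
  factors of profiles \<open>x, e, e, \<dots>\<close> is.

  Strictness is witnessed by the words over \<open>{0, 1, 2}\<close> with equally many, and finitely many,
  letters \<open>0\<close> and \<open>1\<close>.
\<close>


section \<open>Profiles of finite words\<close>

type_synonym 'q profile = "('q \<times> 'q \<times> bool) set"

definition profile_comp :: "'q profile \<Rightarrow> 'q profile \<Rightarrow> 'q profile"  (infixl "\<odot>" 70) where
  "s \<odot> t = {(p, r, b \<or> c) | p q r b c. (p, q, b) \<in> s \<and> (q, r, c) \<in> t}"

definition profile_unit :: "'q profile" where
  "profile_unit = {(p, p, False) | p. True}"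

text \<open>The flag inspects only the source state, so the flags of adjacent factors cover disjoint
  half-open ranges of positions.\<close>

definition letter_profile :: "('q, 'a) buchi \<Rightarrow> 'a \<Rightarrow> 'q profile" where
  "letter_profile A a = {(p, q, p \<in> accepting A) | p q. (p, a, q) \<in> transitions A}"

fun profile :: "('q, 'a) buchi \<Rightarrow> 'a word \<Rightarrow> nat \<Rightarrow> nat \<Rightarrow> 'q profile" where
  "profile A \<alpha> m 0 = profile_unit"
| "profile A \<alpha> m (Suc n) =
     (if m \<le> n then profile A \<alpha> m n \<odot> letter_profile A (\<alpha> n) else profile_unit)"

text \<open>\<open>profile_unit\<close> relates every element of the state type to itself, so it
  need not lie in the power set.\<close>

definition profiles :: "('q, 'a) buchi \<Rightarrow> 'q profile set" where
  "profiles A = insert profile_unit (Pow (states A \<times> states A \<times> UNIV))"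

lemma profile_compI: "(p, q, b) \<in> s \<Longrightarrow> (q, r, c) \<in> t \<Longrightarrow> (p, r, b \<or> c) \<in> s \<odot> t"
  by (auto simp: profile_comp_def)

lemma profile_compE:
  assumes "(p, r, d) \<in> s \<odot> t"
  obtains q b c where "(p, q, b) \<in> s" "(q, r, c) \<in> t" "d = (b \<or> c)"
  using assms by (auto simp: profile_comp_def)

lemma profile_comp_unit [simp]: "s \<odot> profile_unit = s" "profile_unit \<odot> s = s"
  by (auto simp: profile_comp_def profile_unit_def)

lemma profile_comp_assoc: "(s \<odot> t) \<odot> u = s \<odot> (t \<odot> u)"
proof (rule set_eqI, clarify)
  fix p r d
  show "(p, r, d) \<in> (s \<odot> t) \<odot> u \<longleftrightarrow> (p, r, d) \<in> s \<odot> (t \<odot> u)"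
  proof
    assume "(p, r, d) \<in> (s \<odot> t) \<odot> u"
    then obtain q c q' b b' where *: "(p, q', b) \<in> s" "(q', q, b') \<in> t" "(q, r, c) \<in> u"
      "d = ((b \<or> b') \<or> c)" by (elim profile_compE) blast
    then have "(p, r, b \<or> (b' \<or> c)) \<in> s \<odot> (t \<odot> u)" by (intro profile_compI)
    then show "(p, r, d) \<in> s \<odot> (t \<odot> u)" using *(4) by (simp only: disj_assoc)
  next
    assume "(p, r, d) \<in> s \<odot> (t \<odot> u)"
    then obtain q c q' b b' where *: "(p, q, b) \<in> s" "(q, q', b') \<in> t" "(q', r, c) \<in> u"
      "d = (b \<or> (b' \<or> c))" by (elim profile_compE) blast
    then have "(p, r, (b \<or> b') \<or> c) \<in> (s \<odot> t) \<odot> u" by (intro profile_compI)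
    then show "(p, r, d) \<in> (s \<odot> t) \<odot> u" using *(4) by (simp only: disj_assoc)
  qed
qed

lemma profile_self [simp]: "profile A \<alpha> n n = profile_unit"
  by (cases n) auto

lemma profile_concat:
  assumes "k \<le> m" "m \<le> n"
  shows "profile A \<alpha> k m \<odot> profile A \<alpha> m n = profile A \<alpha> k n"
  using assms(2,1)
proof (induction n rule: dec_induct)
  case base
  then show ?case by simp
next
  case (step n)
  then show ?case by (simp add: profile_comp_assoc[symmetric])
qed

lemma letter_profile_in_profiles:
  assumes "wf_buchi A" "s \<in> profiles A"
  shows "s \<odot> letter_profile A a \<in> profiles A"
proof -
  have "letter_profile A a \<subseteq> states A \<times> states A \<times> UNIV"
    using assms(1) by (auto simp: wf_buchi_def letter_profile_def)
  moreover from this have "s \<odot> letter_profile A a \<subseteq> states A \<times> states A \<times> UNIV"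
    if "s \<subseteq> states A \<times> states A \<times> UNIV"
    using that by (fastforce simp: profile_comp_def)
  ultimately show ?thesis
    using assms(2) by (cases "s = profile_unit") (simp_all add: profiles_def)
qed

lemma profile_in_profiles: "wf_buchi A \<Longrightarrow> profile A \<alpha> m n \<in> profiles A"
proof (induction n)
  case (Suc n)
  moreover have "profile_unit \<in> profiles A" by (simp add: profiles_def)
  ultimately show ?case by (simp add: letter_profile_in_profiles)
qed (simp add: profiles_def)

lemma finite_profiles: "wf_buchi A \<Longrightarrow> finite (profiles A)"
  by (simp add: wf_buchi_def wf_base_def profiles_def)

text \<open>Both sides arise by composing the common profile with that of the segment from
  \<open>n\<close> to \<open>n'\<close>.\<close>

lemma profile_persist:
  assumes "profile A \<alpha> k n = profile A \<alpha> k' n" "k \<le> n" "k' \<le> n" "n \<le> n'"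
  shows "profile A \<alpha> k n' = profile A \<alpha> k' n'"
  using profile_concat[of k n n' A \<alpha>] profile_concat[of k' n n' A \<alpha>] assms by simp

lemma profile_of_path:
  assumes "m \<le> n" "\<And>i. m \<le> i \<Longrightarrow> i < n \<Longrightarrow> (p i, \<alpha> i, p (Suc i)) \<in> transitions A"
  shows "(p m, p n, \<exists>i\<in>{m..<n}. p i \<in> accepting A) \<in> profile A \<alpha> m n"
  using assms
proof (induction n rule: dec_induct)
  case base
  then show ?case by (simp add: profile_unit_def)
next
  case (step n)
  have "(p n, p (Suc n), p n \<in> accepting A) \<in> letter_profile A (\<alpha> n)"
    using step by (auto simp: letter_profile_def)
  moreover have "(p m, p n, \<exists>i\<in>{m..<n}. p i \<in> accepting A) \<in> profile A \<alpha> m n"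
    using step by simp
  moreover have "(\<exists>i\<in>{m..<Suc n}. p i \<in> accepting A) \<longleftrightarrow>
      (\<exists>i\<in>{m..<n}. p i \<in> accepting A) \<or> p n \<in> accepting A"
    using step.hyps by (auto simp: less_Suc_eq)
  ultimately show ?case using step.hyps by (simp add: profile_compI)
qed

lemma path_of_profile:
  assumes "m \<le> n" "(q, r, b) \<in> profile A \<alpha> m n"
  shows "\<exists>p. p m = q \<and> p n = r \<and> (\<forall>i. m \<le> i \<and> i < n \<longrightarrow> (p i, \<alpha> i, p (Suc i)) \<in> transitions A)
    \<and> b = (\<exists>i\<in>{m..<n}. p i \<in> accepting A)"
  using assms
proof (induction n arbitrary: r b rule: dec_induct)
  case base
  then show ?case by (auto simp: profile_unit_def)
next
  case (step n)
  then obtain r' c d where *: "(q, r', c) \<in> profile A \<alpha> m n" "(r', r, d) \<in> letter_profile A (\<alpha> n)"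
    "b = (c \<or> d)" by (auto elim!: profile_compE)
  from step.IH[OF *(1)] obtain p where p: "p m = q" "p n = r'"
    "\<forall>i. m \<le> i \<and> i < n \<longrightarrow> (p i, \<alpha> i, p (Suc i)) \<in> transitions A"
    "c = (\<exists>i\<in>{m..<n}. p i \<in> accepting A)" by blast
  have d: "(r', \<alpha> n, r) \<in> transitions A" "d = (r' \<in> accepting A)"
    using *(2) by (auto simp: letter_profile_def)
  let ?p = "p(Suc n := r)"
  have "(\<exists>i\<in>{m..<Suc n}. ?p i \<in> accepting A) \<longleftrightarrow>
      (\<exists>i\<in>{m..<n}. p i \<in> accepting A) \<or> p n \<in> accepting A"
    using step.hyps by (simp add: atLeastLessThanSuc disj_commute)
  moreover have "(?p i, \<alpha> i, ?p (Suc i)) \<in> transitions A" if "m \<le> i" "i < Suc n" for i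
    using that p d(1) by (cases "i = n") auto
  ultimately show ?case
    using step.hyps p d *(3) by (intro exI[of _ ?p]) auto
qed

text \<open>Paths realising consecutive factors agree at the cuts \<open>t j\<close>, so
  \<open>merge\<close> glues them into one run.\<close>

lemma buchi_language_of_profiles:
  assumes "range \<beta> \<subseteq> alphabet A" "idx_sequence t" "a 0 = initial A"
    "\<And>j. (a j, a (Suc j), f j) \<in> profile A \<beta> (t j) (t (Suc j))" "\<exists>\<^sub>\<infinity>j. f j"
  shows "\<beta> \<in> buchi_language A"
proof -
  have lt: "t j < t (Suc j)" for j using assms(2) by (simp add: idx_sequence_def)
  have "\<exists>p. p (t j) = a j \<and> p (t (Suc j)) = a (Suc j) \<and>
      (\<forall>i. t j \<le> i \<and> i < t (Suc j) \<longrightarrow> (p i, \<beta> i, p (Suc i)) \<in> transitions A)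
    \<and> f j = (\<exists>i\<in>{t j..<t (Suc j)}. p i \<in> accepting A)" for j
    using path_of_profile[OF less_imp_le[OF lt] assms(4)] .
  then obtain P where P: "\<And>j. P j (t j) = a j" "\<And>j. P j (t (Suc j)) = a (Suc j)"
    "\<And>j i. t j \<le> i \<Longrightarrow> i < t (Suc j) \<Longrightarrow> (P j i, \<beta> i, P j (Suc i)) \<in> transitions A"
    "\<And>j. f j = (\<exists>i\<in>{t j..<t (Suc j)}. P j i \<in> accepting A)" by metis
  let ?r = "merge P t"
  have r: "?r i = P j i" if "i \<in> {t j..<t (Suc j)}" for i j
    using merge[OF assms(2) that] .
  have "buchi_run A \<beta> ?r"
    unfolding buchi_run_def
  proof (intro conjI allI)
    show "?r 0 = initial A"
      using merge0[OF assms(2), of P] P(1)[of 0] assms(2,3) by (simp add: idx_sequence_def)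
  next
    fix i
    obtain j where j: "i \<in> {t j..<t (Suc j)}" using idx_sequence_interval[OF assms(2)] by blast
    have "?r (Suc i) = P j (Suc i)"
      using merge_Suc[OF assms(2) j, of P] P(1,2) by (auto split: if_splits)
    then show "(?r i, \<beta> i, ?r (Suc i)) \<in> transitions A"
      using r[OF j] P(3)[of j i] j by simp
  qed
  moreover have "\<exists>\<^sub>\<infinity>i. ?r i \<in> accepting A"
    unfolding INFM_nat_le
  proof
    fix m
    obtain j where j: "j \<ge> m" "f j" using assms(5) unfolding INFM_nat_le by blast
    then obtain i where i: "i \<in> {t j..<t (Suc j)}" "P j i \<in> accepting A" using P(4) by auto
    have "strict_mono t" using lt by (simp add: strict_mono_Suc_iff)
    then have "j \<le> t j" by (rule strict_mono_imp_increasing)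
    then show "\<exists>n\<ge>m. ?r n \<in> accepting A" using i j r[OF i(1)]
      by (intro exI[of _ i]) auto
  qed
  ultimately show ?thesis using assms(1) by (auto simp: buchi_language_def)
qed


section \<open>The deterministic automaton\<close>

text \<open>
  \<^const>\<open>remdups\<close> keeps the last of several equal entries. Since new entries are put in front,
  the survivor of a merge is the one that stands for the oldest position.
\<close>

definition next_list :: "('q, 'a) buchi \<Rightarrow> 'q profile list \<Rightarrow> 'a \<Rightarrow> 'q profile list" where
  "next_list A l a = remdups (profile_unit # map (\<lambda>s. s \<odot> letter_profile A a) l)"

fun det_run :: "('q \<Rightarrow> 'a \<Rightarrow> 'q) \<Rightarrow> 'q \<Rightarrow> 'a word \<Rightarrow> 'q word" where
  "det_run \<delta> q \<alpha> 0 = q"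
| "det_run \<delta> q \<alpha> (Suc n) = \<delta> (det_run \<delta> q \<alpha> n) (\<alpha> n)"

abbreviation profile_list :: "('q, 'a) buchi \<Rightarrow> 'a word \<Rightarrow> nat \<Rightarrow> 'q profile list" where
  "profile_list A \<equiv> det_run (next_list A) [profile_unit]"

text \<open>Removing duplicates before or after composing with a letter gives the same list, so the
  stepwise update loses nothing.\<close>

lemma profile_list_eq:
  "profile_list A \<alpha> n = remdups (map (\<lambda>k. profile A \<alpha> k n) (rev [0..<Suc n]))"
proof (induction n)
  case (Suc n)
  let ?f = "\<lambda>s. s \<odot> letter_profile A (\<alpha> n)"
  let ?xs = "map (\<lambda>k. profile A \<alpha> k n) (rev [0..<Suc n])"
  have "profile_list A \<alpha> (Suc n) = remdups (profile_unit # map ?f (remdups ?xs))"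
    by (simp only: det_run.simps next_list_def Suc)
  also have "\<dots> = remdups (profile_unit # map ?f ?xs)"
    by (simp only: remdups.simps remdups_map_remdups set_map set_remdups)
  also have "profile_unit # map ?f ?xs = map (\<lambda>k. profile A \<alpha> k (Suc n)) (rev [0..<Suc (Suc n)])"
    by simp
  finally show ?case .
qed simp

lemma remdups_append_split:
  "remdups (xs @ ys) = filter (\<lambda>x. x \<notin> set ys) (remdups xs) @ remdups ys"
  by (induction xs) auto

section \<open>Ranks of entries and the acceptance condition\<close>

definition oldest :: "nat \<Rightarrow> 'b list \<Rightarrow> 'b list" where
  "oldest i l = drop (length l - i) l"

lemma oldest_append [simp]: "oldest (length ys) (xs @ ys) = ys"
  by (simp add: oldest_def)

text \<open>No two of the \<open>i\<close> oldest entries merge on this transition, so the entry of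
  rank \<open>i\<close> keeps its rank.\<close>

definition stable :: "('q, 'a) buchi \<Rightarrow> nat \<Rightarrow> 'q profile list \<times> 'a \<Rightarrow> bool" where
  "stable A i = (\<lambda>(l, a). 1 \<le> i \<and> i \<le> length l \<and>
     distinct (map (\<lambda>s. s \<odot> letter_profile A a) (oldest i l)))"

text \<open>
  The profile \<^const>\<open>profile_unit\<close> is included for the position that is just being created,
  which may coincide with an older entry at once.
\<close>

definition absorbs :: "('q, 'a) buchi \<Rightarrow> nat \<Rightarrow> 'q profile list \<times> 'a \<Rightarrow> bool" where
  "absorbs A i = (\<lambda>(l, a).
     hd (oldest i l) \<odot> letter_profile A a \<in>
       insert profile_unit ((\<lambda>s. s \<odot> letter_profile A a) ` set (take (length l - i) l)))"

text \<open>The last entry belongs to position 0, so \<open>x\<close> is the profile of the whole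
  prefix, while \<open>e\<close> is the entry of rank \<open>i\<close>.\<close>

definition shows_pair :: "nat \<Rightarrow> 'q profile \<Rightarrow> 'q profile \<Rightarrow> 'q profile list \<times> 'a \<Rightarrow> bool" where
  "shows_pair i x e = (\<lambda>(l, a). last l = x \<and> hd (oldest i l) = e)"

text \<open>These are linked pairs of profiles. The last clause asks for an accepting run through
  factors of profiles \<open>x, e, e, ...\<close>, where \<open>b j\<close> flags an accepting state
  in the factor from \<open>q j\<close> to \<open>q (Suc j)\<close>.\<close>

definition accepting_pair :: "('q, 'a) buchi \<Rightarrow> 'q profile \<Rightarrow> 'q profile \<Rightarrow> bool" where
  "accepting_pair A x e \<longleftrightarrow> x \<odot> e = x \<and> e \<odot> e = e \<and>
     (\<exists>q b c. (initial A, q 0, c) \<in> x \<and> (\<forall>j. (q j, q (Suc j), b j) \<in> e) \<and> (\<exists>\<^sub>\<infinity>j::nat. b j))"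

definition transition_word :: "('q, 'a) buchi \<Rightarrow> 'a word \<Rightarrow> ('q profile list \<times> 'a) word" where
  "transition_word A \<alpha> = (\<lambda>n. (profile_list A \<alpha> n, \<alpha> n))"

definition certified :: "('q, 'a) buchi \<Rightarrow> ('q profile list \<times> 'a) word \<Rightarrow> bool" where
  "certified A \<tau> \<longleftrightarrow> (\<exists>i x e. accepting_pair A x e \<and> (\<forall>\<^sub>\<infinity>n. stable A i (\<tau> n)) \<and>
     (\<exists>\<^sub>\<infinity>n. absorbs A i (\<tau> n)) \<and> (\<exists>\<^sub>\<infinity>n. shows_pair i x e (\<tau> n)))"

lemma last_remdups: "xs \<noteq> [] \<Longrightarrow> last (remdups xs) = last xs"
  by (induction xs) auto

lemma last_profile_list: "last (profile_list A \<alpha> n) = profile A \<alpha> 0 n"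
  unfolding profile_list_eq by (subst last_remdups) (simp_all add: last_rev last_map)

lemma set_profile_list: "set (profile_list A \<alpha> n) = (\<lambda>k. profile A \<alpha> k n) ` {..n}"
  unfolding profile_list_eq set_remdups set_map set_rev set_upt
  by (simp only: atLeast0LessThan lessThan_Suc_atMost)

lemma distinct_profile_list: "distinct (profile_list A \<alpha> n)"
  unfolding profile_list_eq by (rule distinct_remdups)

section \<open>Equivalence of positions\<close>

text \<open>Without the two bounds all positions would meet at \<open>n = 0\<close>, where
  \<open>profile\<close> has its default value.\<close>

definition meets :: "('q, 'a) buchi \<Rightarrow> 'a word \<Rightarrow> nat \<Rightarrow> nat \<Rightarrow> bool" where
  "meets A \<alpha> k k' \<longleftrightarrow> (\<exists>n. k \<le> n \<and> k' \<le> n \<and> profile A \<alpha> k n = profile A \<alpha> k' n)"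

lemma meets_refl: "meets A \<alpha> k k"
  by (auto simp: meets_def)

lemma meets_trans:
  assumes "meets A \<alpha> k l" "meets A \<alpha> l m"
  shows "meets A \<alpha> k m"
proof -
  obtain n n' where "k \<le> n" "l \<le> n" "profile A \<alpha> k n = profile A \<alpha> l n"
    "l \<le> n'" "m \<le> n'" "profile A \<alpha> l n' = profile A \<alpha> m n'"
    using assms by (auto simp: meets_def)
  then show ?thesis
    using profile_persist[of A \<alpha> k n l "max n n'"] profile_persist[of A \<alpha> l n' m "max n n'"]
    unfolding meets_def by (intro exI[of _ "max n n'"]) auto
qed

lemma infinite_meeting_class:
  assumes wf: "wf_buchi A"
  obtains k where "infinite {l. meets A \<alpha> k l}" "\<And>k'. k' < k \<Longrightarrow> \<not> meets A \<alpha> k' k"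
proof -
  \<comment> \<open>Pairwise inequivalent positions have different profiles at every later time, so the set \<open>M\<close>
    of least members of classes is no larger than the set of profiles.\<close>
  define M where "M = {k. \<forall>k'<k. \<not> meets A \<alpha> k' k}"
  have "finite M"
  proof (rule ccontr)
    assume "infinite M"
    then obtain F where F: "finite F" "F \<subseteq> M" "card F = Suc (card (profiles A))"
      using infinite_arbitrarily_large by metis
    let ?f = "\<lambda>k. profile A \<alpha> k (Max F)"
    have "inj_on ?f F"
    proof (rule inj_onI, rule ccontr)
      fix k l assume kl: "k \<in> F" "l \<in> F" "?f k = ?f l" "k \<noteq> l"
      then have "meets A \<alpha> k l" "meets A \<alpha> l k"
        using F(1) unfolding meets_def by (intro exI[of _ "Max F"]; simp)+
      moreover have "k \<in> M" "l \<in> M" using kl F(2) by auto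
      ultimately show False using kl(4) by (cases k l rule: linorder_cases) (auto simp: M_def)
    qed
    then have "card F \<le> card (profiles A)"
      by (rule card_inj_on_le) (auto simp: profile_in_profiles finite_profiles wf)
    then show False using F(3) by simp
  qed
  \<comment> \<open>Each position is sent to the least member of its class. These lie in the finite
    set \<open>M\<close>, so by pigeonhole infinitely many positions share one.\<close>
  define rep where "rep l = (LEAST k. meets A \<alpha> k l)" for l
  have rep: "meets A \<alpha> (rep l) l" for l
    unfolding rep_def by (rule LeastI[of _ l]) (rule meets_refl)
  have "rep l \<in> M" for l
    using meets_trans[OF _ rep[of l]] not_less_Least[of _ "\<lambda>k. meets A \<alpha> k l", folded rep_def]
    by (auto simp: M_def)
  then have "finite (range rep)" using \<open>finite M\<close> by (auto intro: finite_subset)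
  then obtain l where l: "infinite {l'. rep l' = rep l}"
    using pigeonhole_infinite[of UNIV rep] by auto
  show ?thesis
  proof
    show "infinite {l'. meets A \<alpha> (rep l) l'}"
    proof (rule infinite_super[OF _ l], clarify)
      fix l' assume "rep l' = rep l"
      then show "meets A \<alpha> (rep l) l'" using rep[of l'] by simp
    qed
    show "\<And>k'. k' < rep l \<Longrightarrow> \<not> meets A \<alpha> k' (rep l)"
      using \<open>rep l \<in> M\<close> by (auto simp: M_def)
  qed
qed

section \<open>Accepted words are exactly the certified ones\<close>

text \<open>\<open>remdups\<close> deletes an entry only if it recurs nearer the old end. So the
  \<open>i\<close> oldest entries could only be lost by merging with each other, which
  \<open>stable\<close> forbids.\<close>

lemma oldest_stable_step:
  assumes "stable A i (l, a)"
  shows "oldest i (next_list A l a) = map (\<lambda>s. s \<odot> letter_profile A a) (oldest i l)"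
proof -
  let ?f = "\<lambda>s. s \<odot> letter_profile A a"
  let ?ys = "map ?f (oldest i l)"
  have len: "length ?ys = i" using assms by (simp add: stable_def oldest_def)
  have "l = take (length l - i) l @ oldest i l" by (simp add: oldest_def)
  then have "next_list A l a = remdups ((profile_unit # map ?f (take (length l - i) l)) @ ?ys)"
    unfolding next_list_def by (metis append_Cons map_append)
  also have "\<dots> = filter (\<lambda>x. x \<notin> set ?ys) (remdups (profile_unit # map ?f (take (length l - i) l))) @ ?ys"
    using assms unfolding remdups_append_split by (simp add: stable_def distinct_remdups_id)
  finally show ?thesis using oldest_append len by metis
qed

lemma strict_mono_interval:
  fixes t :: "nat \<Rightarrow> nat"
  assumes "strict_mono t" "t m \<le> i"
  obtains j where "m \<le> j" "t j \<le> i" "i < t (Suc j)"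
proof -
  define j where "j = (LEAST j. i < t (Suc j))"
  have "i < t (Suc i)" using strict_mono_imp_increasing[OF assms(1), of "Suc i"] by simp
  then have j: "i < t (Suc j)" unfolding j_def by (rule LeastI)
  then have "m < Suc j" using assms strict_mono_less[OF assms(1)] by (meson le_less_trans)
  moreover have "t j \<le> i"
  proof (cases "j = m")
    case False
    then have "j = Suc (j - 1)" using \<open>m < Suc j\<close> by simp
    then show ?thesis using not_less_Least[of "j - 1" "\<lambda>j. i < t (Suc j)"] by (simp flip: j_def)
  qed (use assms(2) in simp)
  ultimately show ?thesis using that[of j] j by simp
qed

lemma certified_if_accepted:
  assumes wf: "wf_buchi A" and acc: "\<alpha> \<in> buchi_language A"
  shows "certified A (transition_word A \<alpha>)"
proof -
  obtain p where run: "buchi_run A \<alpha> p" and inf: "\<exists>\<^sub>\<infinity>i. p i \<in> accepting A"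
    using acc by (auto simp: buchi_language_def)
  obtain k\<^sub>0 where k0: "infinite {l. meets A \<alpha> k\<^sub>0 l}" and least: "\<And>k. k < k\<^sub>0 \<Longrightarrow> \<not> meets A \<alpha> k k\<^sub>0"
    by (rule infinite_meeting_class[OF wf, where \<alpha> = \<alpha>]) blast
  let ?T = "profile A \<alpha>"
  let ?f = "\<lambda>n s. s \<odot> letter_profile A (\<alpha> n)"
  \<comment> \<open>\<open>s n\<close> is the part of the list that stands for the positions up to \<open>k\<^sub>0\<close>. Its length never grows,
    so it is constant from some \<open>N\<close> on.\<close>
  define s where "s n = remdups (map (\<lambda>k. ?T k n) (rev [0..<Suc k\<^sub>0]))" for n
  have list_split: "\<exists>xs. profile_list A \<alpha> n = xs @ s n" if "k\<^sub>0 \<le> n" for n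
  proof -
    have "[0..<Suc n] = [0..<Suc k\<^sub>0] @ [Suc k\<^sub>0..<Suc n]"
      using upt_add_eq_append[of 0 "Suc k\<^sub>0" "n - k\<^sub>0"] that by simp
    then show ?thesis
      unfolding profile_list_eq s_def by (simp only: rev_append map_append remdups_append_split) blast
  qed
  have s_Suc: "s (Suc n) = remdups (map (?f n) (s n))" if "k\<^sub>0 \<le> n" for n
    unfolding s_def remdups_map_remdups map_map
    by (rule arg_cong[of _ _ remdups], rule map_cong) (use that in auto)
  have len_Suc: "length (s (Suc n)) \<le> length (s n)" if "k\<^sub>0 \<le> n" for n
    using s_Suc[OF that] length_remdups_leq[of "map (?f n) (s n)"] by simp
  obtain N where N: "k\<^sub>0 \<le> N" "\<And>n. k\<^sub>0 \<le> n \<Longrightarrow> length (s N) \<le> length (s n)"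
    using ex_has_least_nat[of "\<lambda>n. k\<^sub>0 \<le> n" "k\<^sub>0" "\<lambda>n. length (s n)"] by blast
  define i where "i = length (s N)"
  have len: "length (s n) = i" if "N \<le> n" for n
    using that
  proof (induction n rule: dec_induct)
    case (step n)
    then have "k\<^sub>0 \<le> n" using N(1) by simp
    then show ?case using step.IH len_Suc[of n] N(2)[of "Suc n"] by (simp add: i_def)
  qed (simp add: i_def)
  have oldest: "oldest i (profile_list A \<alpha> n) = s n" if "N \<le> n" for n
    using list_split[of n] N(1) len[OF that] that by auto
  \<comment> \<open>By minimality of \<open>k\<^sub>0\<close> no older position shares its profile,
    so its entry survives \<open>remdups\<close> as the youngest in \<open>s n\<close>.\<close>
  have hd_s: "hd (s n) = ?T k\<^sub>0 n" if "k\<^sub>0 \<le> n" for n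
  proof -
    have "?T k\<^sub>0 n \<notin> (\<lambda>k. ?T k n) ` {0..<k\<^sub>0}"
      using least that unfolding meets_def by force
    then show ?thesis unfolding s_def by auto
  qed
  have "stable A i (transition_word A \<alpha> n)" if "N \<le> n" for n
  proof -
    have "length (remdups (map (?f n) (s n))) = length (map (?f n) (s n))"
      using len[of n] len[of "Suc n"] s_Suc[of n] that N(1) by simp
    then have "distinct (map (?f n) (s n))" by (simp only: length_remdups_eq remdups_id_iff_distinct)
    moreover have "s n \<noteq> []" unfolding s_def remdups_eq_nil_iff by simp
    moreover have "i \<le> length (profile_list A \<alpha> n)"
      using list_split[of n] len[of n] that N(1) by auto
    ultimately show ?thesis
      using len[OF that] oldest[OF that]
      by (cases "s n") (auto simp: stable_def transition_word_def)
  qed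
  then have stable: "\<forall>\<^sub>\<infinity>n. stable A i (transition_word A \<alpha> n)"
    by (auto simp: MOST_nat_le)
  have absorbs: "\<exists>\<^sub>\<infinity>n. absorbs A i (transition_word A \<alpha> n)"
    unfolding INFM_nat_le
  proof
    fix m
    obtain k where k: "k > max m N" "meets A \<alpha> k\<^sub>0 k"
      using k0 unfolding infinite_nat_iff_unbounded by blast
    \<comment> \<open>The first moment at which \<open>k\<close> agrees with
      \<open>k\<^sub>0\<close>; the absorption happens on the transition into it. In the case
      \<open>k = n'\<close> the position is absorbed on creation.\<close>
    define n' where "n' = (LEAST n. k \<le> n \<and> ?T k n = ?T k\<^sub>0 n)"
    obtain n\<^sub>1 where "k \<le> n\<^sub>1 \<and> ?T k n\<^sub>1 = ?T k\<^sub>0 n\<^sub>1" using k(2) by (auto simp: meets_def)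
    then have n': "k \<le> n'" "?T k n' = ?T k\<^sub>0 n'"
      using LeastI[of "\<lambda>n. k \<le> n \<and> ?T k n = ?T k\<^sub>0 n" n\<^sub>1] by (auto simp: n'_def)
    define n where "n = n' - 1"
    have n: "n' = Suc n" "N \<le> n" "m \<le> n" "k\<^sub>0 \<le> n" using n'(1) k(1) N(1) by (auto simp: n_def)
    have hd: "hd (oldest i (profile_list A \<alpha> n)) \<odot> letter_profile A (\<alpha> n) = ?T k\<^sub>0 n'"
      using oldest hd_s n by simp
    have "absorbs A i (transition_word A \<alpha> n)"
    proof (cases "k = n'")
      case True
      then have "?T k\<^sub>0 n' = profile_unit" using n'(2) by simp
      then show ?thesis by (simp only: absorbs_def transition_word_def split hd insert_iff simp_thms)
    next
      case False
      then have "k \<le> n" using n'(1) n(1) by simp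
      then have neq: "?T k n \<noteq> ?T k\<^sub>0 n"
        using not_less_Least[of n "\<lambda>n. k \<le> n \<and> ?T k n = ?T k\<^sub>0 n"] n(1) by (simp flip: n'_def)
      \<comment> \<open>Otherwise \<open>k\<close> agrees at \<open>n\<close> with some
        \<open>k' \<le> k\<^sub>0\<close>. By choice of \<open>n'\<close> this is not
        \<open>k\<^sub>0\<close>, and a smaller \<open>k'\<close> would meet
        \<open>k\<^sub>0\<close> at \<open>n'\<close>.\<close>
      have "?T k n \<notin> set (s n)"
      proof
        assume "?T k n \<in> set (s n)"
        then obtain k' where k': "k' \<le> k\<^sub>0" "?T k n = ?T k' n"
          unfolding s_def set_remdups set_map set_rev set_upt by (auto simp: less_Suc_eq_le)
        then have "k' < k\<^sub>0" using neq by (cases "k' = k\<^sub>0") auto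
        moreover have "?T k' n' = ?T k\<^sub>0 n'"
          using profile_persist[of A \<alpha> k n k' n'] k' n n'(2) \<open>k \<le> n\<close> by simp
        then have "meets A \<alpha> k' k\<^sub>0" using k'(1) n unfolding meets_def by (intro exI[of _ n']) simp
        ultimately show False using least by blast
      qed
      moreover have "?T k n \<in> set (profile_list A \<alpha> n)"
        using \<open>k \<le> n\<close> by (auto simp: set_profile_list)
      moreover have "profile_list A \<alpha> n =
          take (length (profile_list A \<alpha> n) - i) (profile_list A \<alpha> n) @ s n"
        using oldest[OF n(2)] unfolding oldest_def by (metis append_take_drop_id)
      ultimately have "?T k n \<in> set (take (length (profile_list A \<alpha> n) - i) (profile_list A \<alpha> n))"
        by (metis Un_iff set_append)
      moreover have "?T k n \<odot> letter_profile A (\<alpha> n) = ?T k\<^sub>0 n'"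
        using n'(2) n(1) \<open>k \<le> n\<close> by simp
      ultimately show ?thesis
        unfolding absorbs_def transition_word_def split hd by (intro insertI2) (metis imageI)
    qed
    then show "\<exists>n\<ge>m. absorbs A i (transition_word A \<alpha> n)" using n(3) by blast
  qed
  \<comment> \<open>Members of the class now also serve as times: pigeonhole fixes the pair
    \<open>(x, e)\<close> on an infinite subset \<open>K'\<close> of them.\<close>
  define K where "K = {k. meets A \<alpha> k\<^sub>0 k} - {..N}"
  have "infinite K" using k0 by (simp add: K_def)
  moreover have "finite ((\<lambda>k. (?T 0 k, ?T k\<^sub>0 k)) ` K)"
    by (rule finite_subset[of _ "profiles A \<times> profiles A"])
      (auto simp: profile_in_profiles finite_profiles wf)
  ultimately obtain k\<^sub>1 where k1: "infinite {k \<in> K. (?T 0 k, ?T k\<^sub>0 k) = (?T 0 k\<^sub>1, ?T k\<^sub>0 k\<^sub>1)}"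
    using pigeonhole_infinite by blast
  define x e where "x = ?T 0 k\<^sub>1" and "e = ?T k\<^sub>0 k\<^sub>1"
  define K' where "K' = {k \<in> K. ?T 0 k = x \<and> ?T k\<^sub>0 k = e}"
  have infK': "infinite K'" using k1 by (simp add: K'_def x_def e_def)
  have "\<exists>\<^sub>\<infinity>n. n \<in> K'" using infK' by (simp add: frequently_cofinite)
  then have pair: "\<exists>\<^sub>\<infinity>n. shows_pair i x e (transition_word A \<alpha> n)"
  proof (rule INFM_mono)
    fix n assume "n \<in> K'"
    then show "shows_pair i x e (transition_word A \<alpha> n)"
      using oldest[of n] hd_s[of n] N(1)
      by (auto simp: K'_def K_def shows_pair_def transition_word_def last_profile_list)
  qed
  \<comment> \<open>Once \<open>k\<close> has merged with \<open>k\<^sub>0\<close>, each later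
    \<open>k'\<close> in \<open>K'\<close> satisfies \<open>?T k k' = ?T k\<^sub>0 k' = e\<close>.
    This gives consecutive factors of profile exactly \<open>e\<close>.\<close>
  have "\<exists>\<kappa>. \<forall>n. \<kappa> n \<in> K' \<and> (\<kappa> n < \<kappa> (Suc n) \<and> ?T (\<kappa> n) (\<kappa> (Suc n)) = e)"
  proof (rule dependent_nat_choice)
    show "\<exists>k. k \<in> K'" using infinite_imp_nonempty[OF infK'] by blast
  next
    fix k n assume "k \<in> K'"
    then obtain m where m: "k\<^sub>0 \<le> m" "k \<le> m" "?T k\<^sub>0 m = ?T k m"
      by (auto simp: K'_def K_def meets_def)
    obtain k' where k': "k' > m" "k' \<in> K'"
      using infK' unfolding infinite_nat_iff_unbounded by blast
    then have "?T k k' = e"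
      using profile_persist[of A \<alpha> k\<^sub>0 m k k'] m by (simp add: K'_def)
    then show "\<exists>k'. k' \<in> K' \<and> (k < k' \<and> ?T k k' = e)" using k' m by auto
  qed
  then obtain \<kappa> where \<kappa>: "\<And>n. \<kappa> n \<in> K'" "\<And>n. \<kappa> n < \<kappa> (Suc n)" "\<And>n. ?T (\<kappa> n) (\<kappa> (Suc n)) = e"
    by blast
  have T: "?T 0 (\<kappa> n) = x" "?T k\<^sub>0 (\<kappa> n) = e" "k\<^sub>0 \<le> \<kappa> n" for n
    using \<kappa>(1)[of n] N(1) by (auto simp: K'_def K_def)
  have "x \<odot> e = x" "e \<odot> e = e"
    using profile_concat[of 0 "\<kappa> 0" "\<kappa> 1" A \<alpha>] profile_concat[of k\<^sub>0 "\<kappa> 0" "\<kappa> 1" A \<alpha>]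
      T[of 0] T[of 1] \<kappa>(2)[of 0] \<kappa>(3)[of 0] by simp_all
  moreover have "\<exists>q b c. (initial A, q 0, c) \<in> x \<and> (\<forall>j. (q j, q (Suc j), b j) \<in> e) \<and> (\<exists>\<^sub>\<infinity>j::nat. b j)"
  proof (intro exI conjI allI)
    have path: "(p m, p n, \<exists>i\<in>{m..<n}. p i \<in> accepting A) \<in> ?T m n" if "m \<le> n" for m n
      using run that by (intro profile_of_path) (auto simp: buchi_run_def)
    show "(initial A, (p \<circ> \<kappa>) 0, \<exists>i\<in>{0..<\<kappa> 0}. p i \<in> accepting A) \<in> x"
      using path[of 0 "\<kappa> 0"] T(1)[of 0] run by (simp add: buchi_run_def)
    show "((p \<circ> \<kappa>) j, (p \<circ> \<kappa>) (Suc j), \<exists>i\<in>{\<kappa> j..<\<kappa> (Suc j)}. p i \<in> accepting A) \<in> e" for j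
      using path[OF less_imp_le[OF \<kappa>(2)[of j]]] \<kappa>(3)[of j] by simp
    show "\<exists>\<^sub>\<infinity>j. \<exists>i\<in>{\<kappa> j..<\<kappa> (Suc j)}. p i \<in> accepting A"
      unfolding INFM_nat_le
    proof
      fix m
      obtain i where i: "i \<ge> \<kappa> m" "p i \<in> accepting A" using inf unfolding INFM_nat_le by blast
      have "strict_mono \<kappa>" using \<kappa>(2) by (simp add: strict_mono_Suc_iff)
      from strict_mono_interval[OF this i(1)] i(2)
      show "\<exists>n\<ge>m. \<exists>i\<in>{\<kappa> n..<\<kappa> (Suc n)}. p i \<in> accepting A"
        by (metis atLeastLessThan_iff)
    qed
  qed
  ultimately have "accepting_pair A x e" by (simp add: accepting_pair_def)
  then show ?thesis using stable absorbs pair unfolding certified_def by blast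
qed

lemma accepted_if_certified:
  assumes rng: "range \<beta> \<subseteq> alphabet A" and cert: "certified A (transition_word A \<beta>)"
  shows "\<beta> \<in> buchi_language A"
proof -
  let ?T = "profile A \<beta>" and ?L = "profile_list A \<beta>"
  let ?f = "\<lambda>n s. s \<odot> letter_profile A (\<beta> n)"
  obtain i x e where ap: "accepting_pair A x e"
    and st: "\<forall>\<^sub>\<infinity>n. stable A i (transition_word A \<beta> n)"
    and ab: "\<exists>\<^sub>\<infinity>n. absorbs A i (transition_word A \<beta> n)"
    and sp: "\<exists>\<^sub>\<infinity>n. shows_pair i x e (transition_word A \<beta> n)"
    using cert unfolding certified_def by blast
  obtain N where N: "\<And>n. N \<le> n \<Longrightarrow> stable A i (?L n, \<beta> n)"
    using st unfolding MOST_nat_le transition_word_def by blast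
  have nonempty: "oldest i (?L n) \<noteq> []" if "N \<le> n" for n
    using N[OF that] by (auto simp: stable_def oldest_def)
  have "hd (oldest i (?L N)) \<in> set (?L N)"
    using hd_in_set[OF nonempty[of N]] unfolding oldest_def by (blast intro: in_set_dropD)
  \<comment> \<open>A position behind the entry of rank \<open>i\<close> at time \<open>N\<close>;
    stability makes that entry follow it from then on.\<close>
  then obtain k\<^sub>0 where k0: "k\<^sub>0 \<le> N" "hd (oldest i (?L N)) = ?T k\<^sub>0 N"
    by (auto simp: set_profile_list)
  have hd: "hd (oldest i (?L n)) = ?T k\<^sub>0 n" if "N \<le> n" for n
    using that
  proof (induction n rule: dec_induct)
    case (step n)
    then show ?case
      using oldest_stable_step[OF N[of n]] nonempty[of n] k0(1) by (simp add: hd_map)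
  qed (rule k0(2))
  have inf: "infinite {k. meets A \<beta> k\<^sub>0 k}" (is "infinite ?K")
  proof
    assume fin: "finite ?K"
    have "\<forall>k\<in>?K. \<exists>n. k\<^sub>0 \<le> n \<and> k \<le> n \<and> ?T k\<^sub>0 n = ?T k n" by (simp add: meets_def)
    from bchoice[OF this] obtain g
      where g: "\<And>k. k \<in> ?K \<Longrightarrow> k\<^sub>0 \<le> g k \<and> k \<le> g k \<and> ?T k\<^sub>0 (g k) = ?T k (g k)" by blast
    \<comment> \<open>By time \<open>M\<close> the whole of the supposedly finite class has merged.
      An absorption at \<open>n \<ge> M\<close> would add either the new position
      \<open>Suc n\<close> or one behind a different entry.\<close>
    define M where "M = Max (insert N (g ` ?K))"
    have M: "N \<le> M" "\<And>k. k \<in> ?K \<Longrightarrow> g k \<le> M" using fin by (auto simp: M_def)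
    obtain n where n: "M \<le> n" "absorbs A i (?L n, \<beta> n)"
      using ab unfolding INFM_nat_le transition_word_def by blast
    have Nn: "N \<le> n" "k\<^sub>0 \<le> n" using n M k0 by auto
    have new: "k \<notin> ?K" if "?T k\<^sub>0 n \<noteq> ?T k n \<or> n < k" for k
    proof
      assume "k \<in> ?K"
      then show False
        using that g[of k] M(2)[of k] n(1) profile_persist[of A \<beta> k\<^sub>0 "g k" k n] by auto
    qed
    from n(2) consider "?T k\<^sub>0 (Suc n) = profile_unit"
      | y where "y \<in> set (take (length (?L n) - i) (?L n))" "?T k\<^sub>0 (Suc n) = ?f n y"
      using hd[OF Nn(1)] Nn(2) by (auto simp: absorbs_def)
    then show False
    proof cases
      case 1
      then have "Suc n \<in> ?K" using Nn unfolding meets_def by (intro CollectI exI[of _ "Suc n"]) simp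
      then show False using new by blast
    next
      case 2
      have "y \<in> set (?L n)" using 2(1) by (rule in_set_takeD)
      then obtain k where k: "k \<le> n" "y = ?T k n" by (auto simp: set_profile_list)
      have "k \<in> ?K" using 2(2) k Nn unfolding meets_def by (intro CollectI exI[of _ "Suc n"]) simp
      then have "y = hd (oldest i (?L n))" using new k(2) hd[OF Nn(1)] by auto
      then have "y \<in> set (oldest i (?L n))" using nonempty[OF Nn(1)] by simp
      moreover have "distinct (take (length (?L n) - i) (?L n) @ oldest i (?L n))"
        by (simp only: oldest_def append_take_drop_id distinct_profile_list)
      ultimately show False using 2(1) by auto
    qed
  qed
  have next_pair: "\<exists>t>m. N \<le> t \<and> ?T 0 t = x \<and> ?T k\<^sub>0 t = e" for m
  proof -
    obtain t where "t \<ge> max N (Suc m)" "shows_pair i x e (?L t, \<beta> t)"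
      using sp unfolding INFM_nat_le transition_word_def by blast
    then show ?thesis
      using hd[of t] by (intro exI[of _ t]) (auto simp: shows_pair_def last_profile_list)
  qed
  \<comment> \<open>The next time \<open>t'\<close> is taken so late that some \<open>k > t\<close>
    of the class has already merged with \<open>k\<^sub>0\<close>. The factor from \<open>t\<close>
    to \<open>t'\<close> then ends in a piece of profile \<open>e\<close>, and \<open>e\<close> is
    idempotent.\<close>
  have "\<exists>\<tau>. \<forall>n. (0 < \<tau> n \<and> k\<^sub>0 \<le> \<tau> n \<and> ?T 0 (\<tau> n) = x \<and> ?T k\<^sub>0 (\<tau> n) = e) \<and>
      (\<tau> n < \<tau> (Suc n) \<and> ?T (\<tau> n) (\<tau> (Suc n)) \<odot> e = ?T (\<tau> n) (\<tau> (Suc n)))"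
  proof (rule dependent_nat_choice)
    show "\<exists>t. 0 < t \<and> k\<^sub>0 \<le> t \<and> ?T 0 t = x \<and> ?T k\<^sub>0 t = e"
      using next_pair[of 0] k0(1) by auto
  next
    fix t n :: nat
    obtain k where k: "t < k" "meets A \<beta> k\<^sub>0 k"
      using inf unfolding infinite_nat_iff_unbounded by blast
    then obtain m where m: "k\<^sub>0 \<le> m" "k \<le> m" "?T k\<^sub>0 m = ?T k m" by (auto simp: meets_def)
    obtain t' where t': "m < t'" "N \<le> t'" "?T 0 t' = x" "?T k\<^sub>0 t' = e" using next_pair by blast
    have "?T k t' = e" using profile_persist[of A \<beta> k\<^sub>0 m k t'] m t' by simp
    then have "?T t t' = ?T t k \<odot> e" using profile_concat[of t k t' A \<beta>] k m t' by simp
    then have "?T t t' \<odot> e = ?T t t'" using ap by (simp add: profile_comp_assoc accepting_pair_def)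
    then show "\<exists>t'. (0 < t' \<and> k\<^sub>0 \<le> t' \<and> ?T 0 t' = x \<and> ?T k\<^sub>0 t' = e) \<and>
        (t < t' \<and> ?T t t' \<odot> e = ?T t t')"
      using t' k m k0(1) by (intro exI[of _ t']) auto
  qed
  then obtain \<tau> where \<tau>: "\<And>n. 0 < \<tau> n" "\<And>n. k\<^sub>0 \<le> \<tau> n" "\<And>n. ?T 0 (\<tau> n) = x" "\<And>n. ?T k\<^sub>0 (\<tau> n) = e"
    "\<And>n. \<tau> n < \<tau> (Suc n)" "\<And>n. ?T (\<tau> n) (\<tau> (Suc n)) \<odot> e = ?T (\<tau> n) (\<tau> (Suc n))"
    by blast
  let ?z = "\<lambda>n. ?T (\<tau> n) (\<tau> (Suc n))"
  have ez: "e \<odot> ?z n = e" for n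
    using profile_concat[of k\<^sub>0 "\<tau> n" "\<tau> (Suc n)" A \<beta>] \<tau>(2,4)[of n] \<tau>(4)[of "Suc n"] \<tau>(5)[of n]
    by simp
  obtain q b c where q: "(initial A, q 0, c) \<in> x" "\<And>j. (q j, q (Suc j), b j) \<in> e" "\<exists>\<^sub>\<infinity>j::nat. b j"
    and xe: "x \<odot> e = x"
    using ap unfolding accepting_pair_def by blast
  \<comment> \<open>Each \<open>e\<close>-step \<open>q j \<rightarrow> q (Suc j)\<close> is split as \<open>q j \<rightarrow> a j \<rightarrow> q (Suc j)\<close> along \<open>e = e z\<^sub>j\<close>. Regrouping
    along \<open>z\<^sub>j e = z\<^sub>j\<close> gives \<open>z\<^sub>j\<close>-steps \<open>a j \<rightarrow> a (Suc j)\<close>.\<close>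
  have "\<exists>a c d. (q j, a, c) \<in> e \<and> (a, q (Suc j), d) \<in> ?z j \<and> b j = (c \<or> d)" for j
  proof -
    have "(q j, q (Suc j), b j) \<in> e \<odot> ?z j" using q(2)[of j] ez[of j] by simp
    then show ?thesis by (elim profile_compE) blast
  qed
  then obtain a c' d where a: "\<And>j. (q j, a j, c' j) \<in> e" "\<And>j. (a j, q (Suc j), d j) \<in> ?z j"
    "\<And>j. b j = (c' j \<or> d j)" by metis
  show ?thesis
  proof (rule buchi_language_of_profiles[OF rng])
    show "idx_sequence (case_nat 0 \<tau>)"
      using \<tau>(1,5) by (auto simp: idx_sequence_def split: nat.split)
    show "case_nat (initial A) a 0 = initial A" by simp
    show "(case_nat (initial A) a j, case_nat (initial A) a (Suc j),
        case_nat (c \<or> c' 0) (\<lambda>j. d j \<or> c' (Suc j)) j)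
      \<in> ?T (case_nat 0 \<tau> j) (case_nat 0 \<tau> (Suc j))" for j
    proof (cases j)
      case 0
      have "(initial A, a 0, c \<or> c' 0) \<in> x \<odot> e" using q(1) a(1) by (rule profile_compI)
      then show ?thesis using 0 \<tau>(3)[of 0] xe by simp
    next
      case (Suc m)
      have "(a m, a (Suc m), d m \<or> c' (Suc m)) \<in> ?z m \<odot> e" using a(2,1) by (rule profile_compI)
      then show ?thesis using Suc \<tau>(6)[of m] by simp
    qed
    \<comment> \<open>The part \<open>c' j\<close> of the flag \<open>b j\<close> sits at index
      \<open>j\<close>, the part \<open>d j\<close> at index \<open>Suc j\<close>.\<close>
    show "\<exists>\<^sub>\<infinity>j. case_nat (c \<or> c' 0) (\<lambda>j. d j \<or> c' (Suc j)) j"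
      unfolding INFM_nat_le
    proof
      fix m
      obtain j where j: "j \<ge> m" "b j" using q(3) unfolding INFM_nat_le by blast
      then consider "c' j" | "d j" using a(3) by blast
      then show "\<exists>n\<ge>m. case_nat (c \<or> c' 0) (\<lambda>j. d j \<or> c' (Suc j)) n"
      proof cases
        case 1
        then show ?thesis using j(1) by (intro exI[of _ j]) (auto split: nat.split)
      next
        case 2
        then show ?thesis using j(1) by (intro exI[of _ "Suc j"]) auto
      qed
    qed
  qed
qed


section \<open>Muller conditions as semi-linear sets\<close>

text \<open>The base is \<open>\<infinity>\<close> on \<open>X\<close> and 0 elsewhere. Unit vectors
  for the coordinates outside \<open>X\<close>, with natural coefficients, yield exactly the finite
  values there.\<close>

lemma is_linear_infinite_positions:
  "is_linear d {x. length x = d \<and> (\<forall>j<d. x ! j = \<infinity> \<longleftrightarrow> j \<in> X)}" (is "is_linear d ?S")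
proof -
  define b where "b = map (\<lambda>j. if j \<in> X then \<infinity> else 0 :: enat) [0..<d]"
  define u where "u i = map (\<lambda>j. if j = i then 1 else 0 :: enat) [0..<d]" for i
  define J where "J = {..<d} - X"
  \<comment> \<open>Coefficients are indexed by period vectors, so different coordinates need
    different vectors.\<close>
  have inj: "inj_on u J"
  proof (rule inj_onI)
    fix i j assume "i \<in> J" "j \<in> J" "u i = u j"
    then have "u i ! i = u j ! i" "i < d" by (auto simp: J_def)
    then show "i = j" by (auto simp: u_def split: if_splits)
  qed
  have nth: "b ! j + (\<Sum>p\<in>u ` J. p ! j * enat (z p)) = (if j \<in> X then \<infinity> else enat (z (u j)))"
    if "j < d" for z j
  proof -
    have "(\<Sum>p\<in>u ` J. p ! j * enat (z p)) = (\<Sum>i\<in>J. u i ! j * enat (z (u i)))"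
      using inj by (simp add: sum.reindex)
    also have "\<dots> = (\<Sum>i\<in>J. if j = i then enat (z (u i)) else 0)"
      using that by (intro sum.cong) (auto simp: u_def)
    also have "\<dots> = (if j \<in> X then 0 else enat (z (u j)))"
      using that by (subst sum.delta') (auto simp: J_def)
    finally show ?thesis using that by (simp add: b_def)
  qed
  have "linear_set d b (u ` J) = ?S"
  proof (intro equalityI subsetI)
    fix x assume "x \<in> linear_set d b (u ` J)"
    then show "x \<in> ?S" by (auto simp: linear_set_def nth split: if_splits)
  next
    fix x assume x: "x \<in> ?S"
    define z where "z p = the_enat (x ! inv_into J u p)" for p
    have "x = map (\<lambda>j. b ! j + (\<Sum>p\<in>u ` J. p ! j * enat (z p))) [0..<d]"
    proof (rule nth_equalityI)
      fix j assume "j < length x"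
      then have j: "j < d" using x by simp
      have "x ! j = (if j \<in> X then \<infinity> else enat (z (u j)))"
        using x j inj by (cases "x ! j") (auto simp: z_def J_def)
      then show "x ! j = map (\<lambda>j. b ! j + (\<Sum>p\<in>u ` J. p ! j * enat (z p))) [0..<d] ! j"
        using nth[OF j, of z] j by simp
    qed (use x in simp)
    then show "x \<in> linear_set d b (u ` J)" unfolding linear_set_def by blast
  qed
  then show ?thesis
    unfolding is_linear_def
    by (intro exI[of _ b] exI[of _ "u ` J"]) (auto simp: b_def u_def J_def)
qed

text \<open>Coordinate \<open>j\<close> counts the uses of \<open>ks ! j\<close>, so it is infinite
  iff that transition is in the limit. The union \<open>C\<close> is finite for every
  \<open>\<F>\<close>, since it ranges over subsets of \<open>{..<d}\<close>.\<close>

lemma det_limit_PA_recognizable_Muller: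
  fixes \<delta> :: "'q \<Rightarrow> 'a \<Rightarrow> 'q" and \<F> :: "('q \<times> 'a) set set"
  assumes fin: "finite Q" "finite \<Sigma>" "\<Sigma> \<noteq> {}" and q0: "q\<^sub>0 \<in> Q"
    and closed: "\<And>q a. q \<in> Q \<Longrightarrow> a \<in> \<Sigma> \<Longrightarrow> \<delta> q a \<in> Q"
  shows "det_limit_PA_recognizable \<Sigma>
    {\<alpha>. range \<alpha> \<subseteq> \<Sigma> \<and> limit (\<lambda>n. (det_run \<delta> q\<^sub>0 \<alpha> n, \<alpha> n)) \<in> \<F>}"
proof -
  obtain ks where ks: "set ks = Q \<times> \<Sigma>" "distinct ks"
    using finite_distinct_list[of "Q \<times> \<Sigma>"] fin by auto
  define d where "d = length ks"
  define vec :: "'q \<times> 'a \<Rightarrow> nat list" where "vec k = map (\<lambda>k'. if k' = k then 1 else 0) ks" for k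
  define C where "C = (\<Union>X\<in>Pow {..<d} \<inter> {X. (\<lambda>j. ks ! j) ` X \<in> \<F>}.
    {x :: enat list. length x = d \<and> (\<forall>j<d. x ! j = \<infinity> \<longleftrightarrow> j \<in> X)})"
  define A :: "('q, 'a) limit_PA" where
    "A = \<lparr>states = Q, alphabet = \<Sigma>, initial = q\<^sub>0,
      transitions = {(q, a, vec (q, a), \<delta> q a) | q a. q \<in> Q \<and> a \<in> \<Sigma>}, accepting = Q,
      pa_dim = d, pa_set = C\<rparr>"
  have "is_semilinear d C"
    unfolding is_semilinear_def C_def
    by (rule exI[of _ "(\<lambda>X. {x. length x = d \<and> (\<forall>j<d. x ! j = \<infinity> \<longleftrightarrow> j \<in> X)}) `
      (Pow {..<d} \<inter> {X. (\<lambda>j. ks ! j) ` X \<in> \<F>})"]) (auto simp: is_linear_infinite_positions)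
  moreover have "1 \<le> d" using ks(1) q0 fin(3) by (cases ks) (auto simp: d_def)
  moreover have "finite (transitions A)"
    by (rule finite_subset[of _ "(\<lambda>(q, a). (q, a, vec (q, a), \<delta> q a)) ` (Q \<times> \<Sigma>)"])
      (use fin in \<open>auto simp: A_def\<close>)
  ultimately have wf: "wf_limit_PA A"
    using fin q0 closed by (auto simp: wf_limit_PA_def wf_base_def A_def vec_def d_def)
  have det: "deterministic A"
    by (auto simp: deterministic_def A_def)
  have image: "extended_parikh_image d (\<lambda>n. vec (det_run \<delta> q\<^sub>0 \<alpha> n, \<alpha> n)) \<in> C \<longleftrightarrow>
      limit (\<lambda>n. (det_run \<delta> q\<^sub>0 \<alpha> n, \<alpha> n)) \<in> \<F>"
    if rng: "range (\<lambda>n. (det_run \<delta> q\<^sub>0 \<alpha> n, \<alpha> n)) \<subseteq> Q \<times> \<Sigma>" for \<alpha>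
  proof -
    let ?k = "\<lambda>n. (det_run \<delta> q\<^sub>0 \<alpha> n, \<alpha> n)"
    let ?x = "extended_parikh_image d (\<lambda>n. vec (?k n))"
    have len: "length ?x = d" by (simp add: extended_parikh_image_def)
    have x: "?x ! j = \<infinity> \<longleftrightarrow> ks ! j \<in> limit ?k" if "j < d" for j
    proof -
      have "vec k ! j \<noteq> 0 \<longleftrightarrow> k = ks ! j" for k
        using that by (auto simp: vec_def d_def)
      then show ?thesis using that by (simp add: extended_parikh_image_def limit_def)
    qed
    define X where "X = {j. j < d \<and> ks ! j \<in> limit ?k}"
    have "limit ?k \<subseteq> set ks" using limit_in_range[of ?k] rng ks(1) by blast
    then have X: "(\<lambda>j. ks ! j) ` X = limit ?k"
      unfolding X_def d_def set_conv_nth by blast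
    show ?thesis
    proof
      assume "?x \<in> C"
      then obtain Y where Y: "Y \<subseteq> {..<d}" "(\<lambda>j. ks ! j) ` Y \<in> \<F>" "\<forall>j<d. ?x ! j = \<infinity> \<longleftrightarrow> j \<in> Y"
        unfolding C_def by blast
      then have "Y = X" using x unfolding X_def by blast
      then show "limit ?k \<in> \<F>" using Y(2) X by simp
    next
      assume "limit ?k \<in> \<F>"
      then have "X \<in> Pow {..<d} \<inter> {X. (\<lambda>j. ks ! j) ` X \<in> \<F>}" using X by (auto simp: X_def)
      moreover have "length ?x = d \<and> (\<forall>j<d. ?x ! j = \<infinity> \<longleftrightarrow> j \<in> X)"
        using len x by (simp add: X_def)
      ultimately show "?x \<in> C" unfolding C_def by blast
    qed
  qed
  have run_in: "det_run \<delta> q\<^sub>0 \<alpha> n \<in> Q" if "range \<alpha> \<subseteq> \<Sigma>" for \<alpha> n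
    by (induction n) (simp_all add: q0 closed range_subsetD[OF that])
  have "limit_PA_language A = {\<alpha>. range \<alpha> \<subseteq> \<Sigma> \<and> limit (\<lambda>n. (det_run \<delta> q\<^sub>0 \<alpha> n, \<alpha> n)) \<in> \<F>}"
    unfolding limit_PA_language_def
  proof (rule Collect_cong, rule conj_cong)
    fix \<alpha> :: "'a word" assume rng: "range \<alpha> \<subseteq> \<Sigma>"
    let ?k = "\<lambda>n. (det_run \<delta> q\<^sub>0 \<alpha> n, \<alpha> n)"
    have unique: "p = det_run \<delta> q\<^sub>0 \<alpha> \<and> v = (\<lambda>n. vec (?k n))" if "limit_PA_run A \<alpha> p v" for p v
    proof -
      have step: "v n = vec (p n, \<alpha> n) \<and> p (Suc n) = \<delta> (p n) (\<alpha> n)" for n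
        using that by (auto simp: limit_PA_run_def A_def)
      have p0: "p 0 = q\<^sub>0" using that by (simp add: limit_PA_run_def A_def)
      have "p n = det_run \<delta> q\<^sub>0 \<alpha> n" for n by (induction n) (simp_all add: p0 step)
      then show ?thesis by (simp add: fun_eq_iff step)
    qed
    have run: "limit_PA_run A \<alpha> (det_run \<delta> q\<^sub>0 \<alpha>) (\<lambda>n. vec (?k n))"
      by (simp add: limit_PA_run_def A_def run_in[OF rng] range_subsetD[OF rng])
    have frequent: "\<exists>\<^sub>\<infinity>n. det_run \<delta> q\<^sub>0 \<alpha> n \<in> accepting A"
      by (simp add: A_def run_in[OF rng])
    have "range ?k \<subseteq> Q \<times> \<Sigma>" using run_in[OF rng] rng by blast
    from image[OF this] have *: "extended_parikh_image (pa_dim A) (\<lambda>n. vec (?k n)) \<in> pa_set A \<longleftrightarrow>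
        limit ?k \<in> \<F>" by (simp add: A_def)
    show "(\<exists>p v. limit_PA_run A \<alpha> p v \<and> (\<exists>\<^sub>\<infinity>i. p i \<in> accepting A) \<and>
        extended_parikh_image (pa_dim A) v \<in> pa_set A) \<longleftrightarrow> limit ?k \<in> \<F>"
      unfolding *[symmetric] using run frequent unique by blast
  qed (simp add: A_def)
  then show ?thesis using det_limit_PA_recognizableI[OF wf det] by (simp add: A_def)
qed

text \<open>Over a finite range, a property holds infinitely often iff some element of the limit has
  it; holding almost always is the dual. So \<open>certified\<close> is a Muller condition.\<close>

lemma certified_limit_cong:
  assumes "limit \<sigma> = limit \<tau>" "finite (range \<sigma>)" "finite (range \<tau>)"
  shows "certified A \<sigma> \<longleftrightarrow> certified A \<tau>"
proof -
  have inf: "(\<exists>\<^sub>\<infinity>n. P (\<rho> n)) \<longleftrightarrow> (\<exists>k\<in>limit \<rho>. P k)" if "finite (range \<rho>)" for P \<rho>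
  proof -
    have "(\<exists>\<^sub>\<infinity>n. P (\<rho> n)) \<longleftrightarrow> (\<exists>\<^sub>\<infinity>n. \<rho> n \<in> range \<rho> \<inter> Collect P)" by simp
    also have "\<dots> \<longleftrightarrow> limit \<rho> \<inter> (range \<rho> \<inter> Collect P) \<noteq> {}"
      using that by (intro fin_ex_inf_eq_limit) simp
    also have "\<dots> \<longleftrightarrow> (\<exists>k\<in>limit \<rho>. P k)" using limit_in_range[of \<rho>] by blast
    finally show ?thesis .
  qed
  then have frequent: "(\<exists>\<^sub>\<infinity>n. P (\<sigma> n)) \<longleftrightarrow> (\<exists>\<^sub>\<infinity>n. P (\<tau> n))" for P
    using inf[OF assms(2), of P] inf[OF assms(3), of P] assms(1) by simp
  have "(\<forall>\<^sub>\<infinity>n. P (\<sigma> n)) \<longleftrightarrow> (\<forall>\<^sub>\<infinity>n. P (\<tau> n))" for P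
    using frequent[of "\<lambda>k. \<not> P k"] not_INFM[of "\<lambda>n. \<not> P (\<sigma> n)"] not_INFM[of "\<lambda>n. \<not> P (\<tau> n)"] by simp
  then show ?thesis unfolding certified_def using frequent by presburger
qed

lemma omega_regular_imp_det_limit_PA_recognizable:
  assumes "omega_regular \<Sigma> L"
  shows "det_limit_PA_recognizable \<Sigma> L"
proof -
  obtain A :: "(nat, 'a) buchi" where wf: "wf_buchi A" and A: "alphabet A = \<Sigma>" "buchi_language A = L"
    using assms unfolding omega_regular_def by blast
  define Q where "Q = {l. set l \<subseteq> profiles A \<and> distinct l}"
  \<comment> \<open>The Muller family consists of the limits produced by words of \<open>L\<close>.
    A word sharing its limit with one of them is certified as well, hence in
    \<open>L\<close>.\<close>
  define \<F> where "\<F> = (\<lambda>\<alpha>. limit (transition_word A \<alpha>)) ` L"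
  have fin: "finite \<Sigma>" "\<Sigma> \<noteq> {}" using wf A(1) by (auto simp: wf_buchi_def wf_base_def)
  have finQ: "finite Q" unfolding Q_def using finite_profiles[OF wf] by (rule finite_subset_distinct)
  have finite_range: "finite (range (transition_word A \<alpha>))" if "range \<alpha> \<subseteq> \<Sigma>" for \<alpha>
  proof (rule finite_subset)
    show "range (transition_word A \<alpha>) \<subseteq> Q \<times> \<Sigma>"
      using that by (auto simp: transition_word_def Q_def set_profile_list distinct_profile_list
        profile_in_profiles[OF wf])
  qed (use finQ fin in simp)
  have rng: "range \<alpha> \<subseteq> \<Sigma>" if "\<alpha> \<in> L" for \<alpha>
    using that A by (auto simp: buchi_language_def)
  have "\<beta> \<in> L" if \<beta>: "range \<beta> \<subseteq> \<Sigma>" "limit (transition_word A \<beta>) \<in> \<F>" for \<beta>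
  proof -
    obtain \<alpha> where \<alpha>: "\<alpha> \<in> L" "limit (transition_word A \<beta>) = limit (transition_word A \<alpha>)"
      using \<beta>(2) by (auto simp: \<F>_def)
    have "certified A (transition_word A \<alpha>)" using certified_if_accepted[OF wf] \<alpha>(1) A(2) by simp
    then have "certified A (transition_word A \<beta>)"
      using certified_limit_cong[OF \<alpha>(2)] finite_range \<beta>(1) rng \<alpha>(1) by blast
    then show ?thesis using accepted_if_certified \<beta>(1) A by blast
  qed
  then have "L = {\<alpha>. range \<alpha> \<subseteq> \<Sigma> \<and> limit (transition_word A \<alpha>) \<in> \<F>}"
    using rng by (auto simp: \<F>_def)
  moreover have "det_limit_PA_recognizable \<Sigma> {\<alpha>. range \<alpha> \<subseteq> \<Sigma> \<and>
      limit (\<lambda>n. (det_run (next_list A) [profile_unit] \<alpha> n, \<alpha> n)) \<in> \<F>}"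
  proof (rule det_limit_PA_recognizable_Muller[OF finQ fin])
    show "[profile_unit] \<in> Q" by (simp add: Q_def profiles_def)
    show "next_list A l a \<in> Q" if "l \<in> Q" for l a
    proof -
      have "profile_unit \<in> profiles A" by (simp add: profiles_def)
      then show ?thesis
        using that letter_profile_in_profiles[OF wf] by (auto simp: Q_def next_list_def)
    qed
  qed
  ultimately show ?thesis by (simp only: transition_word_def)
qed


section \<open>Strictness\<close>

definition balanced_language :: "nat word set" where
  "balanced_language = {\<alpha>. range \<alpha> \<subseteq> {0, 1, 2} \<and>
     finite {i. \<alpha> i = 0} \<and> finite {i. \<alpha> i = 1} \<and> card {i. \<alpha> i = 0} = card {i. \<alpha> i = 1}}"

lemma det_limit_PA_recognizable_balanced_language:
  "det_limit_PA_recognizable {0, 1, 2} balanced_language"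
proof -
  define vec :: "nat \<Rightarrow> nat list" where "vec a = [if a = 0 then 1 else 0, if a = 1 then 1 else 0]" for a
  define C where "C = linear_set 2 [0, 0] {[1, 1]}"
  define A :: "(unit, nat) limit_PA" where
    "A = \<lparr>states = {()}, alphabet = {0, 1, 2}, initial = (),
      transitions = (\<lambda>a. ((), a, vec a, ())) ` {0, 1, 2}, accepting = {()},
      pa_dim = 2, pa_set = C\<rparr>"
  \<comment> \<open>Coefficients are natural numbers, so \<open>[\<infinity>, \<infinity>]\<close>
    is not in \<open>C\<close>; this enforces finitely many letters 0 and 1.\<close>
  have C: "C = {[enat z, enat z] | z. True}"
  proof -
    have "C = {[enat (z [1, 1]), enat (z [1, 1])] | z :: enat list \<Rightarrow> nat. True}"
      by (simp add: C_def linear_set_def numeral_2_eq_2)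
    also have "\<dots> = {[enat z, enat z] | z. True}" by (auto intro: exI[of _ "\<lambda>_. z" for z])
    finally show ?thesis .
  qed
  have "is_semilinear 2 C"
    unfolding is_semilinear_def is_linear_def C_def
    by (intro exI[of _ "{linear_set 2 [0, 0] {[1, 1]}}"] conjI ballI exI[of _ "[0, 0]"]
        exI[of _ "{[1, 1]}"]) auto
  then have wf: "wf_limit_PA A"
    by (auto simp: wf_limit_PA_def wf_base_def A_def vec_def)
  have det: "deterministic A"
    by (auto simp: deterministic_def A_def)
  have image: "extended_parikh_image 2 (\<lambda>i. vec (\<alpha> i)) \<in> C \<longleftrightarrow>
      finite {i. \<alpha> i = 0} \<and> finite {i. \<alpha> i = 1} \<and> card {i. \<alpha> i = 0} = card {i. \<alpha> i = 1}" for \<alpha>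
    by (auto simp: extended_parikh_image_def numeral_2_eq_2 C vec_def frequently_cofinite)
  have run: "limit_PA_run A \<alpha> p v \<longleftrightarrow> v = (\<lambda>i. vec (\<alpha> i))" if "range \<alpha> \<subseteq> {0, 1, 2}" for \<alpha> p v
  proof -
    have "(p i, \<alpha> i, v i, p (Suc i)) \<in> transitions A \<longleftrightarrow> \<alpha> i \<in> {0, 1, 2} \<and> v i = vec (\<alpha> i)" for i
      by (auto simp: A_def)
    then have "limit_PA_run A \<alpha> p v \<longleftrightarrow> (\<forall>i. v i = vec (\<alpha> i))"
      using range_subsetD[OF that] by (simp add: limit_PA_run_def)
    then show ?thesis by (simp add: fun_eq_iff)
  qed
  have "limit_PA_language A = balanced_language"
    unfolding limit_PA_language_def balanced_language_def
    by (rule Collect_cong, rule conj_cong) (use image run in \<open>auto simp: A_def\<close>)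
  then show ?thesis using det_limit_PA_recognizableI[OF wf det] by (simp add: A_def)
qed

text \<open>By pigeonhole, accepting runs on \<open>0^n 1^n 2^\<omega>\<close> for two different
  \<open>n\<close> share the state after the zeros. Exchanging tails accepts an unbalanced
  word.\<close>

lemma not_omega_regular_balanced_language: "\<not> omega_regular {0, 1, 2} balanced_language"
proof
  assume "omega_regular {0, 1, 2} balanced_language"
  then obtain A :: "(nat, nat) buchi" where wf: "wf_buchi A" and A: "buchi_language A = balanced_language"
    "alphabet A = {0, 1, 2}" unfolding omega_regular_def by blast
  define w :: "nat \<Rightarrow> nat \<Rightarrow> nat word" where
    "w n m i = (if i < n then 0 else if i < n + m then 1 else 2)" for n m i
  have "{i. w n m i = 0} = {..<n}" "{i. w n m i = 1} = {n..<n + m}" for n m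
    by (auto simp: w_def split: if_splits)
  moreover have range_w: "range (w n m) \<subseteq> {0, 1, 2}" for n m by (auto simp: w_def)
  ultimately have w: "w n m \<in> balanced_language \<longleftrightarrow> n = m" for n m
    using range_w by (simp add: balanced_language_def)
  have "\<exists>p. buchi_run A (w n n) p \<and> (\<exists>\<^sub>\<infinity>i. p i \<in> accepting A)" for n
    using w[of n n] A(1) unfolding buchi_language_def by blast
  then obtain P where P: "\<And>n. buchi_run A (w n n) (P n)" "\<And>n. \<exists>\<^sub>\<infinity>i. P n i \<in> accepting A"
    by metis
  have "(P n n, w n n n, P n (Suc n)) \<in> transitions A" for n
    using P(1) by (simp add: buchi_run_def)
  moreover have "transitions A \<subseteq> states A \<times> alphabet A \<times> states A"
    using wf by (simp add: wf_buchi_def)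
  ultimately have "P n n \<in> states A" for n by blast
  then have "range (\<lambda>n. P n n) \<subseteq> states A" by blast
  moreover have "finite (states A)" using wf by (simp add: wf_buchi_def wf_base_def)
  ultimately have fin: "finite (range (\<lambda>n. P n n))" by (rule finite_subset)
  have "\<not> inj (\<lambda>n. P n n)"
  proof
    assume "inj (\<lambda>n. P n n)"
    then show False using finite_imageD[OF fin] by simp
  qed
  then obtain n m where nm: "n \<noteq> m" "P n n = P m m" unfolding inj_def by blast
  \<comment> \<open>\<open>P n\<close> up to time \<open>n\<close>, continued by \<open>P m\<close>
    from its time \<open>m\<close> on; the seam fits because \<open>P n n = P m m\<close>.\<close>
  define p where "p i = (if i \<le> n then P n i else P m (i - n + m))" for i
  have "buchi_run A (w n m) p"
    unfolding buchi_run_def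
  proof (intro conjI allI)
    show "p 0 = initial A" using P(1)[of n] by (simp add: p_def buchi_run_def)
    fix i
    show "(p i, w n m i, p (Suc i)) \<in> transitions A"
    proof (cases "i < n")
      case True
      then have "p i = P n i" "p (Suc i) = P n (Suc i)" "w n m i = w n n i"
        by (simp_all add: p_def w_def)
      then show ?thesis using P(1)[of n] by (simp add: buchi_run_def)
    next
      case False
      then have "p i = P m (i - n + m)" "p (Suc i) = P m (Suc (i - n + m))"
        "w n m i = w m m (i - n + m)"
        using nm(2) by (auto simp: p_def w_def Suc_diff_le)
      then show ?thesis using P(1)[of m] by (simp add: buchi_run_def)
    qed
  qed
  moreover have "\<exists>\<^sub>\<infinity>i. p i \<in> accepting A"
    unfolding INFM_nat_le
  proof
    fix k
    obtain i where i: "i \<ge> Suc (k + m)" "P m i \<in> accepting A" using P(2)[of m] unfolding INFM_nat_le by blast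
    then have "\<not> i - m + n \<le> n" "i - m + n - n + m = i" by simp_all
    then have "p (i - m + n) = P m i" by (simp only: p_def if_False)
    then show "\<exists>j\<ge>k. p j \<in> accepting A" using i by (intro exI[of _ "i - m + n"]) simp
  qed
  moreover have "range (w n m) \<subseteq> alphabet A" using A(2) range_w by simp
  ultimately have "w n m \<in> balanced_language" unfolding A(1)[symmetric] buchi_language_def by blast
  then show False using w nm(1) by simp
qed

theorem lemma8:
  shows "(\<forall>(\<Sigma> :: 'a set) L. omega_regular \<Sigma> L \<longrightarrow> det_limit_PA_recognizable \<Sigma> L) \<and>
    (\<exists>(\<Sigma> :: nat set) L. det_limit_PA_recognizable \<Sigma> L \<and> \<not> omega_regular \<Sigma> L)"
  using omega_regular_imp_det_limit_PA_recognizable det_limit_PA_recognizable_balanced_language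
    not_omega_regular_balanced_language by blast

end
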